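(* Let $K$ be any simplicial complex. Then the simplicial map $\pi=(\alpha,\omega)\colon \mathrm{P}K\to K\times K$, sending a Moore path to the pair formed by its initial and final vertices, is a simplicial finite-fibration.
   Context: Simplicial complexes are abstract simplicial complexes, not necessarily finite; simplicial maps are maps of vertex sets sending simplices to simplices. The (categorical) product $K\times L$ has vertex set $V(K)\times V(L)$, and a finite set of vertices is a simplex iff both its projections are simplices. For $m\ge1$, $I_m$ is the one-dimensional complex with vertices $0,\dots,m$ and edges $\{j,j+1\}$, $0\le j<m$. A simplicial map $p\colon E\to B$ is a simplicial finite-fibration if for every finite simplicial complex $L$, every $m\ge1$, and all simplicial maps $H\colon L\times I_m\to B$ and $\varphi\colon L\times\{0\}\to E$ with $p(\varphi(v,0))=H(v,0)$ for all vertices $v$, there is a simplicial map $\widetilde H\colon L\times I_m\to E$ with $\widetilde H(v,0)=\varphi(v,0)$ for all $v$ and $p\circ\widetilde H=H$. Let $Z$ be the one-dimensional simplicial complex with vertex set $\mathbb Z$ and edges $\{i,i+1\}$, $i\in\mathbb Z$. A Moore path in $K$ is a simplicial map $\gamma\colon Z\to K$ for which there are integers $i^-,i^+$ with $\gamma(i)=\gamma(i^-)$ for all $i\le i^-$ and $\gamma(i)=\gamma(i^+)$ for all $i\ge i^+$. The eventual value of $\gamma$ on the left is its initial vertex $\alpha(\gamma)$ and the eventual value on the right is its final vertex $\omega(\gamma)$. The Moore path complex $\mathrm{P}K$ has as vertices all Moore paths in $K$, and a finite set $\{\gamma_0,\dots,\gamma_p\}$ is a simplex of $\mathrm{P}K$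 iff $\{\gamma_0(i),\dots,\gamma_p(i),\gamma_0(i+1),\dots,\gamma_p(i+1)\}$ is a simplex of $K$ for every $i\in\mathbb Z$. The maps $\alpha,\omega\colon \mathrm{P}K\to K$ are simplicial. *)

theory Defs
  imports Main
begin

text \<open>
  A complex is given by its set of simplices, which are nonempty finite sets.  Its vertices
  are the \<open>v\<close> with \<open>{v}\<close> a simplex, equivalently the elements of the union of all simplices.
\<close>

definition abstract_simplicial_complex :: "'a set set \<Rightarrow> bool" where
  "abstract_simplicial_complex K \<longleftrightarrow>
     (\<forall>\<sigma>\<in>K. finite \<sigma> \<and> \<sigma> \<noteq> {} \<and> (\<forall>\<tau>. \<tau> \<noteq> {} \<longrightarrow> \<tau> \<subseteq> \<sigma> \<longrightarrow> \<tau> \<in> K))"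

definition vertex_set :: "'a set set \<Rightarrow> 'a set" where
  "vertex_set K = \<Union>K"

text \<open>
  Maps are total functions on the ambient types; only their values on the vertex set of the
  source matter.
\<close>

definition simplicial_map :: "'a set set \<Rightarrow> 'b set set \<Rightarrow> ('a \<Rightarrow> 'b) \<Rightarrow> bool" where
  "simplicial_map K L f \<longleftrightarrow>
     f ` vertex_set K \<subseteq> vertex_set L \<and> (\<forall>\<sigma>\<in>K. f ` \<sigma> \<in> L)"

definition product_complex :: "'a set set \<Rightarrow> 'b set set \<Rightarrow> ('a \<times> 'b) set set" where
  "product_complex K L =
     {\<sigma>. finite \<sigma> \<and> \<sigma> \<subseteq> vertex_set K \<times> vertex_set L \<and> fst ` \<sigma> \<in> K \<and> snd ` \<sigma> \<in> L}"

definition interval_complex :: "nat \<Rightarrow> nat set set" where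
  "interval_complex m = {{j} | j. j \<le> m} \<union> {{j, j + 1} | j. j < m}"

definition line_complex :: "int set set" where
  "line_complex = {{i} | i. True} \<union> {{i, i + 1} | i. True}"

text \<open>
  The type argument is the type of the vertices of the test complexes \<open>L\<close>.  It is needed
  because HOL has no quantification over types inside a formula; the property is to be read
  as holding for every choice of that type, so theorems should keep it as a type variable.
\<close>

definition simplicial_finite_fibration ::
  "'l itself \<Rightarrow> 'e set set \<Rightarrow> 'b set set \<Rightarrow> ('e \<Rightarrow> 'b) \<Rightarrow> bool" where
  "simplicial_finite_fibration (T :: 'l itself) E B p \<longleftrightarrow>
     simplicial_map E B p \<and>
     (\<forall>(L :: 'l set set) (m :: nat) H \<phi>.
        abstract_simplicial_complex L \<longrightarrow> finite (vertex_set L) \<longrightarrow> m \<ge> 1 \<longrightarrow>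
        simplicial_map (product_complex L (interval_complex m)) B H \<longrightarrow>
        simplicial_map (product_complex L {{0 :: nat}}) E \<phi> \<longrightarrow>
        (\<forall>v\<in>vertex_set L. p (\<phi> (v, 0)) = H (v, 0)) \<longrightarrow>
        (\<exists>H'. simplicial_map (product_complex L (interval_complex m)) E H' \<and>
              (\<forall>v\<in>vertex_set L. H' (v, 0) = \<phi> (v, 0)) \<and>
              (\<forall>x\<in>vertex_set (product_complex L (interval_complex m)). p (H' x) = H x)))"

definition moore_path :: "'a set set \<Rightarrow> (int \<Rightarrow> 'a) \<Rightarrow> bool" where
  "moore_path K \<gamma> \<longleftrightarrow>
     simplicial_map line_complex K \<gamma> \<and>
     (\<exists>a b. (\<forall>i\<le>a. \<gamma> i = \<gamma> a) \<and> (\<forall>i\<ge>b. \<gamma> i = \<gamma> b))"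

definition initial_vertex :: "(int \<Rightarrow> 'a) \<Rightarrow> 'a" where
  "initial_vertex \<gamma> = (THE v. \<exists>a. \<forall>i\<le>a. \<gamma> i = v)"

definition final_vertex :: "(int \<Rightarrow> 'a) \<Rightarrow> 'a" where
  "final_vertex \<gamma> = (THE v. \<exists>b. \<forall>i\<ge>b. \<gamma> i = v)"

definition moore_path_complex :: "'a set set \<Rightarrow> (int \<Rightarrow> 'a) set set" where
  "moore_path_complex K =
     {\<Gamma>. finite \<Gamma> \<and> \<Gamma> \<noteq> {} \<and> (\<forall>\<gamma>\<in>\<Gamma>. moore_path K \<gamma>) \<and>
         (\<forall>i. (\<lambda>\<gamma>. \<gamma> i) ` \<Gamma> \<union> (\<lambda>\<gamma>. \<gamma> (i + 1)) ` \<Gamma> \<in> K)}"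

definition endpoint_map :: "(int \<Rightarrow> 'a) \<Rightarrow> 'a \<times> 'a" where
  "endpoint_map \<gamma> = (initial_vertex \<gamma>, final_vertex \<gamma>)"

lemma vertex_set_iff:
  "abstract_simplicial_complex K \<Longrightarrow> v \<in> vertex_set K \<longleftrightarrow> {v} \<in> K"
  unfolding abstract_simplicial_complex_def vertex_set_def by blast

lemma abstract_simplicial_complex_subset:
  "abstract_simplicial_complex K \<Longrightarrow> \<sigma> \<in> K \<Longrightarrow> \<tau> \<noteq> {} \<Longrightarrow> \<tau> \<subseteq> \<sigma> \<Longrightarrow> \<tau> \<in> K"
  unfolding abstract_simplicial_complex_def by blast

lemma abstract_simplicial_complex_product:
  assumes "abstract_simplicial_complex K" "abstract_simplicial_complex L"
  shows "abstract_simplicial_complex (product_complex K L)"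
  unfolding abstract_simplicial_complex_def
proof (intro ballI conjI allI impI)
  fix \<sigma> assume s: "\<sigma> \<in> product_complex K L"
  then show "finite \<sigma>" by (simp add: product_complex_def)
  have "fst ` \<sigma> \<in> K" using s by (simp add: product_complex_def)
  then show "\<sigma> \<noteq> {}" using assms(1) unfolding abstract_simplicial_complex_def by blast
  fix \<tau> assume t: "\<tau> \<noteq> {}" "\<tau> \<subseteq> \<sigma>"
  have f: "fst ` \<sigma> \<in> K" and g: "snd ` \<sigma> \<in> L" using s by (simp_all add: product_complex_def)
  have "fst ` \<tau> \<in> K"
    by (rule abstract_simplicial_complex_subset[OF assms(1) f]) (use t in auto)
  moreover have "snd ` \<tau> \<in> L"
    by (rule abstract_simplicial_complex_subset[OF assms(2) g]) (use t in auto)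
  ultimately show "\<tau> \<in> product_complex K L"
    using s t(2) finite_subset[OF t(2)] subset_trans[OF t(2)] by (simp add: product_complex_def)
qed

lemma vertex_set_product:
  assumes "abstract_simplicial_complex K" "abstract_simplicial_complex L"
  shows "vertex_set (product_complex K L) = vertex_set K \<times> vertex_set L"
proof -
  have "{(v, w)} \<in> product_complex K L" if "v \<in> vertex_set K" "w \<in> vertex_set L" for v w
    using that vertex_set_iff[OF assms(1), of v] vertex_set_iff[OF assms(2), of w]
    by (simp add: product_complex_def)
  then have "vertex_set K \<times> vertex_set L \<subseteq> vertex_set (product_complex K L)"
    unfolding vertex_set_def[of "product_complex K L"] by blast
  moreover have "vertex_set (product_complex K L) \<subseteq> vertex_set K \<times> vertex_set L"
    unfolding vertex_set_def[of "product_complex K L"]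
    by (intro Union_least) (simp add: product_complex_def)
  ultimately show ?thesis by blast
qed

lemma abstract_simplicial_complex_interval: "abstract_simplicial_complex (interval_complex m)"
  unfolding abstract_simplicial_complex_def
proof (intro ballI conjI allI impI)
  fix \<sigma> assume "\<sigma> \<in> interval_complex m"
  then obtain a b where s: "\<sigma> = {a, b}" "a \<le> m" "b \<le> m" "{a, b} \<in> interval_complex m"
  proof -
    assume hyp: "\<And>a b. \<sigma> = {a, b} \<Longrightarrow> a \<le> m \<Longrightarrow> b \<le> m \<Longrightarrow> {a, b} \<in> interval_complex m \<Longrightarrow> thesis"
    have "(\<exists>j\<le>m. \<sigma> = {j, j}) \<or> (\<exists>j. j < m \<and> \<sigma> = {j, j + 1})"
      using \<open>\<sigma> \<in> interval_complex m\<close> unfolding interval_complex_def by blast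
    then show thesis
    proof (elim disjE exE conjE)
      fix j assume "j \<le> m" "\<sigma> = {j, j}"
      with \<open>\<sigma> \<in> interval_complex m\<close> show thesis by (intro hyp[of j j]) simp_all
    next
      fix j assume "j < m" "\<sigma> = {j, j + 1}"
      with \<open>\<sigma> \<in> interval_complex m\<close> show thesis by (intro hyp[of j "j + 1"]) simp_all
    qed
  qed
  show "finite \<sigma>" "\<sigma> \<noteq> {}" using s(1) by simp_all
  fix \<tau> assume "\<tau> \<noteq> {}" "\<tau> \<subseteq> \<sigma>"
  then have "\<tau> = {a} \<or> \<tau> = {b} \<or> \<tau> = {a, b}" unfolding s(1) by blast
  moreover have "{j} \<in> interval_complex m" if "j \<le> m" for j
    using that unfolding interval_complex_def by blast
  ultimately show "\<tau> \<in> interval_complex m" using s by blast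
qed

lemma vertex_set_interval: "vertex_set (interval_complex m) = {..m}"
proof -
  have "{v} \<in> interval_complex m \<longleftrightarrow> v \<le> m" for v
    unfolding interval_complex_def by auto
  then show ?thesis using vertex_set_iff[OF abstract_simplicial_complex_interval] by blast
qed

lemma moore_path_edge: "moore_path K \<gamma> \<Longrightarrow> {\<gamma> i, \<gamma> (i + 1)} \<in> K"
proof -
  assume "moore_path K \<gamma>"
  moreover have "{i, i + 1} \<in> line_complex" unfolding line_complex_def by blast
  ultimately have "\<gamma> ` {i, i + 1} \<in> K" unfolding moore_path_def simplicial_map_def by blast
  then show ?thesis by simp
qed

lemma vertex_set_moore_path_complex:
  "vertex_set (moore_path_complex K) = {\<gamma>. moore_path K \<gamma>}"
proof -
  have "{\<gamma>} \<in> moore_path_complex K" if "moore_path K \<gamma>" for \<gamma>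
    using that moore_path_edge[OF that] by (simp add: moore_path_complex_def insert_commute)
  moreover have "moore_path K \<gamma>" if "\<gamma> \<in> \<Gamma>" "\<Gamma> \<in> moore_path_complex K" for \<gamma> \<Gamma>
    using that by (simp add: moore_path_complex_def)
  ultimately show ?thesis unfolding vertex_set_def by blast
qed

lemma abstract_simplicial_complex_moore_path_complex:
  assumes "abstract_simplicial_complex K"
  shows "abstract_simplicial_complex (moore_path_complex K)"
  unfolding abstract_simplicial_complex_def
proof (intro ballI conjI allI impI)
  fix \<sigma> assume s: "\<sigma> \<in> moore_path_complex K"
  then show "finite \<sigma>" "\<sigma> \<noteq> {}" by (simp_all add: moore_path_complex_def)
  fix \<tau> assume t: "\<tau> \<noteq> {}" "\<tau> \<subseteq> \<sigma>"
  have "(\<lambda>\<gamma>. \<gamma> i) ` \<tau> \<union> (\<lambda>\<gamma>. \<gamma> (i + 1)) ` \<tau> \<in> K" for i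
  proof -
    have "(\<lambda>\<gamma>. \<gamma> i) ` \<sigma> \<union> (\<lambda>\<gamma>. \<gamma> (i + 1)) ` \<sigma> \<in> K"
      using s by (simp add: moore_path_complex_def)
    moreover have "(\<lambda>\<gamma>. \<gamma> i) ` \<tau> \<union> (\<lambda>\<gamma>. \<gamma> (i + 1)) ` \<tau>
        \<subseteq> (\<lambda>\<gamma>. \<gamma> i) ` \<sigma> \<union> (\<lambda>\<gamma>. \<gamma> (i + 1)) ` \<sigma>"
      using t(2) by blast
    moreover have "(\<lambda>\<gamma>. \<gamma> i) ` \<tau> \<union> (\<lambda>\<gamma>. \<gamma> (i + 1)) ` \<tau> \<noteq> {}" using t(1) by simp
    ultimately show ?thesis using abstract_simplicial_complex_subset[OF assms] by simp
  qed
  then show "\<tau> \<in> moore_path_complex K"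
    using s t(1) finite_subset[OF t(2)] subsetD[OF t(2)] by (simp add: moore_path_complex_def)
qed

lemma initial_vertex_eq:
  assumes "\<forall>i\<le>a. \<gamma> i = v"
  shows "initial_vertex \<gamma> = v"
  unfolding initial_vertex_def
proof (rule the_equality)
  show "w = v" if "\<exists>a. \<forall>i\<le>a. \<gamma> i = w" for w
  proof -
    from that obtain c where "\<forall>i\<le>c. \<gamma> i = w" ..
    with assms have "\<gamma> (min a c) = v" "\<gamma> (min a c) = w" by (meson min.cobounded1, meson min.cobounded2)
    then show ?thesis by simp
  qed
qed (use assms in blast)

lemma final_vertex_eq:
  assumes "\<forall>i\<ge>b. \<gamma> i = v"
  shows "final_vertex \<gamma> = v"
  unfolding final_vertex_def
proof (rule the_equality)
  show "w = v" if "\<exists>b. \<forall>i\<ge>b. \<gamma> i = w" for w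
  proof -
    from that obtain c where "\<forall>i\<ge>c. \<gamma> i = w" ..
    with assms have "\<gamma> (max b c) = v" "\<gamma> (max b c) = w" by (meson max.cobounded1, meson max.cobounded2)
    then show ?thesis by simp
  qed
qed (use assms in blast)

end

(* The lift at (v, j) runs backwards along the first component of H(v, -) from time j to time 0,
   then along the Moore path phi(v, 0), then forwards along the second component from time 0 to
   time j.  Since L is finite, all the paths phi(v, 0) are constant outside one common interval
   [a, b], so for every v the two outer pieces can be attached at the same positions a and b. *)
theory Submission
  imports Defs
begin

lemma simplicial_mapI:
  assumes "\<And>\<sigma>. \<sigma> \<in> K \<Longrightarrow> f ` \<sigma> \<in> L"
  shows "simplicial_map K L f"
  using assms unfolding simplicial_map_def vertex_set_def by blast

lemma simplicial_map_image: "simplicial_map K L f \<Longrightarrow> \<sigma> \<in> K \<Longrightarrow> f ` \<sigma> \<in> L"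
  unfolding simplicial_map_def by blast

lemma simplicial_map_product_components:
  assumes "simplicial_map M (product_complex K L) f"
  shows "simplicial_map M K (\<lambda>x. fst (f x))" and "simplicial_map M L (\<lambda>x. snd (f x))"
  using simplicial_map_image[OF assms]
  by (simp_all add: simplicial_mapI product_complex_def image_image)

text \<open>Every simplex of a product lies in the box spanned by its two projections. With closure
  under nonempty subsets, simplex conditions can therefore be checked on such boxes.\<close>

lemma times_in_product_complex:
  assumes "abstract_simplicial_complex K" "abstract_simplicial_complex L" "\<sigma> \<in> K" "\<tau> \<in> L"
  shows "\<sigma> \<times> \<tau> \<in> product_complex K L"
proof -
  have "finite \<sigma>" "finite \<tau>" "\<sigma> \<noteq> {}" "\<tau> \<noteq> {}" "\<sigma> \<subseteq> vertex_set K" "\<tau> \<subseteq> vertex_set L"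
    using assms unfolding abstract_simplicial_complex_def vertex_set_def by blast+
  then show ?thesis using assms(3,4) by (simp add: product_complex_def Sigma_mono)
qed

text \<open>Finitely many stabilisation indices have a common minimum and maximum. Strictness of
  \<open>a < b\<close> keeps the two constant regions disjoint, so that later the two outer pieces
  of a lifted path do not overlap.\<close>

lemma moore_path_bounds:
  assumes "finite \<Gamma>" "\<And>\<gamma>. \<gamma> \<in> \<Gamma> \<Longrightarrow> moore_path K \<gamma>"
  obtains a b where "a < b"
    "\<And>\<gamma> i. \<gamma> \<in> \<Gamma> \<Longrightarrow> i \<le> a \<Longrightarrow> \<gamma> i = initial_vertex \<gamma>"
    "\<And>\<gamma> i. \<gamma> \<in> \<Gamma> \<Longrightarrow> b \<le> i \<Longrightarrow> \<gamma> i = final_vertex \<gamma>"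
proof -
  have "\<exists>a b. a < b \<and> (\<forall>\<gamma>\<in>\<Gamma>. (\<forall>i\<le>a. \<gamma> i = initial_vertex \<gamma>) \<and> (\<forall>i\<ge>b. \<gamma> i = final_vertex \<gamma>))"
    using assms
  proof (induction \<Gamma> rule: finite_induct)
    case empty
    \<comment> \<open>Any two integers \<open>a < b\<close> serve here. The empty family does arise,
      namely from a test complex without vertices.\<close>
    show ?case by (intro exI[of _ 0] exI[of _ 1]) simp
  next
    case (insert \<gamma> \<Gamma>)
    have "\<And>\<beta>. \<beta> \<in> \<Gamma> \<Longrightarrow> moore_path K \<beta>" using insert.prems by simp
    from insert.IH[OF this] obtain a b where ab: "a < b"
      "\<forall>\<gamma>\<in>\<Gamma>. (\<forall>i\<le>a. \<gamma> i = initial_vertex \<gamma>) \<and> (\<forall>i\<ge>b. \<gamma> i = final_vertex \<gamma>)" by blast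
    have "moore_path K \<gamma>" using insert.prems by simp
    then obtain c d where cd: "\<forall>i\<le>c. \<gamma> i = \<gamma> c" "\<forall>i\<ge>d. \<gamma> i = \<gamma> d"
      unfolding moore_path_def by (elim conjE exE)
    have "\<forall>i\<le>c. \<gamma> i = initial_vertex \<gamma>" "\<forall>i\<ge>d. \<gamma> i = final_vertex \<gamma>"
      unfolding initial_vertex_eq[OF cd(1)] final_vertex_eq[OF cd(2)] by (fact cd)+
    with ab(2) have "\<forall>\<gamma>\<in>insert \<gamma> \<Gamma>. (\<forall>i\<le>min a c. \<gamma> i = initial_vertex \<gamma>) \<and>
        (\<forall>i\<ge>max b d. \<gamma> i = final_vertex \<gamma>)" by simp
    moreover have "min a c < max b d" using ab(1) by linarith
    ultimately show ?case by blast
  qed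
  then show thesis using that by blast
qed

text \<open>Evaluating a simplex of paths at one index gives a face of its edge condition. At the
  common bounds \<open>a\<close> and \<open>b\<close> these slices are the sets of initial and of
  final vertices, and the image lies in their box.\<close>

lemma simplicial_map_endpoint_map:
  assumes K: "abstract_simplicial_complex K"
  shows "simplicial_map (moore_path_complex K) (product_complex K K) endpoint_map"
proof (rule simplicial_mapI)
  fix \<Gamma> assume G: "\<Gamma> \<in> moore_path_complex K"
  then have fin: "finite \<Gamma>" "\<Gamma> \<noteq> {}" "\<And>\<gamma>. \<gamma> \<in> \<Gamma> \<Longrightarrow> moore_path K \<gamma>"
    and edge: "\<And>i. (\<lambda>\<gamma>. \<gamma> i) ` \<Gamma> \<union> (\<lambda>\<gamma>. \<gamma> (i + 1)) ` \<Gamma> \<in> K"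
    by (simp_all add: moore_path_complex_def)
  obtain a b where ab: "a < b" "\<And>\<gamma> i. \<gamma> \<in> \<Gamma> \<Longrightarrow> i \<le> a \<Longrightarrow> \<gamma> i = initial_vertex \<gamma>"
    "\<And>\<gamma> i. \<gamma> \<in> \<Gamma> \<Longrightarrow> b \<le> i \<Longrightarrow> \<gamma> i = final_vertex \<gamma>"
    using moore_path_bounds[OF fin(1,3)] by blast
  have slice: "(\<lambda>\<gamma>. \<gamma> i) ` \<Gamma> \<in> K" for i
    by (rule abstract_simplicial_complex_subset[OF K edge[of i]]) (use fin in auto)
  have "initial_vertex ` \<Gamma> \<in> K" "final_vertex ` \<Gamma> \<in> K"
    using slice[of a] slice[of b] ab(2)[of _ a] ab(3)[of _ b] by (simp_all cong: image_cong)
  then have "initial_vertex ` \<Gamma> \<times> final_vertex ` \<Gamma> \<in> product_complex K K"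
    by (intro times_in_product_complex K)
  then show "endpoint_map ` \<Gamma> \<in> product_complex K K"
    by (rule abstract_simplicial_complex_subset[OF abstract_simplicial_complex_product[OF K K]])
      (use fin in \<open>auto simp: endpoint_map_def\<close>)
qed

text \<open>The minimum is simplicial even on the categorical product, where diagonals count: the
  minima of \<open>t\<close>, \<open>t + 1\<close> with \<open>j\<close>, \<open>j + 1\<close> are
  at most two neighbouring values. For \<open>t\<close> beyond \<open>m\<close> they saturate, so
  the result stays in the interval.\<close>

lemma truncated_interval_simplex:
  assumes "\<tau> \<in> interval_complex m"
  shows "min t ` \<tau> \<union> min (t + 1) ` \<tau> \<in> interval_complex m"
proof -
  have mem: "{s} \<in> interval_complex m" if "s \<le> m" for s
    using that unfolding interval_complex_def by blast
  have mem2: "{s, s + 1} \<in> interval_complex m" if "s < m" for s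
    using that unfolding interval_complex_def by blast
  from assms consider j where "j \<le> m" "\<tau> = {j}" | j where "j < m" "\<tau> = {j, j + 1}"
    unfolding interval_complex_def by blast
  then show ?thesis
  proof cases
    case (1 j)
    show ?thesis
    proof (cases "t < j")
      case True
      then show ?thesis using 1 mem2[of t] by (simp add: min_def insert_commute)
    next
      case False
      then have "min t j = j" "min (t + 1) j = j" by simp_all
      then show ?thesis using 1 mem[of j] by simp
    qed
  next
    case (2 j)
    consider "t < j" | "t = j" | "t > j" by linarith
    then show ?thesis
    proof cases
      case 1
      then show ?thesis using 2 mem2[of t] by (simp add: min_def insert_commute)
    next
      case b: 2
      then show ?thesis using 2 mem2[of j] by (simp add: min_def insert_commute)
    next
      case 3
      then have "min t j = j" "min (t + 1) j = j" "min t (j + 1) = j + 1"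
        "min (t + 1) (j + 1) = j + 1" by simp_all
      then show ?thesis using 2 mem2[of j] by simp
    qed
  qed
qed

text \<open>Stopping a homotopy at the consecutive times \<open>t\<close> and \<open>t + 1\<close>
  yields adjacent vertices, jointly over a whole simplex: all values lie in the
  \<open>h\<close>-image of one box, whose second factor is the truncated simplex of times.\<close>

lemma truncated_homotopy_simplex:
  assumes K: "abstract_simplicial_complex K" and L: "abstract_simplicial_complex L"
    and h: "simplicial_map (product_complex L (interval_complex m)) K h"
    and \<sigma>: "\<sigma> \<in> product_complex L (interval_complex m)"
  shows "(\<lambda>(v, j). h (v, min t j)) ` \<sigma> \<union> (\<lambda>(v, j). h (v, min (t + 1) j)) ` \<sigma> \<in> K"
proof -
  let ?S = "min t ` snd ` \<sigma> \<union> min (t + 1) ` snd ` \<sigma>"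
  have p: "fst ` \<sigma> \<in> L" "snd ` \<sigma> \<in> interval_complex m"
    using \<sigma> by (simp_all add: product_complex_def)
  then have ne: "\<sigma> \<noteq> {}" using L unfolding abstract_simplicial_complex_def by blast
  have "fst ` \<sigma> \<times> ?S \<in> product_complex L (interval_complex m)"
    by (intro times_in_product_complex L abstract_simplicial_complex_interval p
        truncated_interval_simplex)
  then have "h ` (fst ` \<sigma> \<times> ?S) \<in> K" by (rule simplicial_map_image[OF h])
  moreover have "(v, min t j) \<in> fst ` \<sigma> \<times> ?S" "(v, min (t + 1) j) \<in> fst ` \<sigma> \<times> ?S"
    if "(v, j) \<in> \<sigma>" for v j
    using imageI[OF that, of fst] imageI[OF that, of snd] by auto
  then have "(\<lambda>(v, j). h (v, min t j)) ` \<sigma> \<union> (\<lambda>(v, j). h (v, min (t + 1) j)) ` \<sigma>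
      \<subseteq> h ` (fst ` \<sigma> \<times> ?S)"
    by (intro Un_least image_subsetI) (clarsimp simp only: prod.case, rule imageI, assumption)+
  ultimately show ?thesis using abstract_simplicial_complex_subset[OF K] ne by simp
qed

text \<open>\<open>h\<close> and \<open>k\<close> stand for the two components of the homotopy. At
  distance \<open>d\<close> outside \<open>a\<close> or \<open>b\<close> the outer piece shows time
  \<open>d\<close>, and it stays at time \<open>j\<close> once \<open>d\<close> exceeds
  \<open>j\<close>. Thus the level \<open>j\<close> changes only the length of the outer pieces, not
  where they are attached.\<close>

definition extended_path ::
  "int \<Rightarrow> int \<Rightarrow> ('l \<times> nat \<Rightarrow> 'a) \<Rightarrow> ('l \<times> nat \<Rightarrow> 'a) \<Rightarrow> ('l \<times> nat \<Rightarrow> int \<Rightarrow> 'a) \<Rightarrow>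
    'l \<times> nat \<Rightarrow> int \<Rightarrow> 'a" where
  "extended_path a b h k \<phi> = (\<lambda>(v, j) i.
     if i \<le> a then h (v, min (nat (a - i)) j)
     else if b \<le> i then k (v, min (nat (i - b)) j)
     else \<phi> (v, 0) i)"

lemma extended_path_left: "i \<le> a - int j \<Longrightarrow> extended_path a b h k \<phi> (v, j) i = h (v, j)"
  by (simp add: extended_path_def min_absorb2 le_nat_iff)

lemma extended_path_right:
  "a < b \<Longrightarrow> b + int j \<le> i \<Longrightarrow> extended_path a b h k \<phi> (v, j) i = k (v, j)"
  by (simp add: extended_path_def min_absorb2 le_nat_iff)

text \<open>At \<open>a\<close> and \<open>b\<close> the outer pieces are at time 0 and agree there
  with the middle path. Having the closed interval lets the edges that touch a junction be handled
  by \<open>\<phi>\<close> alone.\<close>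

lemma extended_path_middle:
  assumes "a \<le> i" "i \<le> b" "\<phi> (v, 0) a = h (v, 0)" "\<phi> (v, 0) b = k (v, 0)"
  shows "extended_path a b h k \<phi> (v, j) i = \<phi> (v, 0) i"
  using assms by (auto simp: extended_path_def)

text \<open>At level 0 all truncated times vanish, so the outer pieces only prolong the constant
  ends of \<open>\<phi> (v, 0)\<close>.\<close>

lemma extended_path_0:
  assumes "\<And>i. i \<le> a \<Longrightarrow> \<phi> (v, 0) i = h (v, 0)" "\<And>i. b \<le> i \<Longrightarrow> \<phi> (v, 0) i = k (v, 0)"
  shows "extended_path a b h k \<phi> (v, 0) = \<phi> (v, 0)"
  using assms by (auto simp: extended_path_def fun_eq_iff)

lemma endpoint_map_extended_path:
  "a < b \<Longrightarrow> endpoint_map (extended_path a b h k \<phi> (v, j)) = (h (v, j), k (v, j))"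
  unfolding endpoint_map_def
  by (simp add: initial_vertex_eq[of "a - int j"] final_vertex_eq[of "b + int j"]
      extended_path_left extended_path_right)

text \<open>Since \<open>a\<close> and \<open>b\<close> are the same for all vertices of
  \<open>\<sigma>\<close>, the edge from \<open>i\<close> to \<open>i + 1\<close> lies in the same
  region for all the paths. Values of \<open>h\<close>, \<open>\<phi>\<close> and \<open>k\<close>
  are therefore never compared with each other.\<close>

lemma extended_path_simplex:
  assumes K: "abstract_simplicial_complex K" and L: "abstract_simplicial_complex L"
    and h: "simplicial_map (product_complex L (interval_complex m)) K h"
    and k: "simplicial_map (product_complex L (interval_complex m)) K k"
    and \<phi>: "simplicial_map (product_complex L {{0}}) (moore_path_complex K) \<phi>"
    and ends: "\<And>v. v \<in> vertex_set L \<Longrightarrow> \<phi> (v, 0) a = h (v, 0)"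
      "\<And>v. v \<in> vertex_set L \<Longrightarrow> \<phi> (v, 0) b = k (v, 0)"
    and \<sigma>: "\<sigma> \<in> product_complex L (interval_complex m)" and ab: "a < b"
  defines "P \<equiv> extended_path a b h k \<phi>"
  shows "(\<lambda>x. P x i) ` \<sigma> \<union> (\<lambda>x. P x (i + 1)) ` \<sigma> \<in> K"
proof -
  consider "i < a" | "a \<le> i" "i < b" | "b \<le> i" by linarith
  then show ?thesis
  proof cases
    case 1
    \<comment> \<open>The left piece runs backwards in time: index \<open>i + 1\<close> has the
      earlier time \<open>t\<close> and index \<open>i\<close> the time \<open>t + 1\<close>, hence
      the swapped union below.\<close>
    define t where "t = nat (a - (i + 1))"
    have "nat (a - i) = t + 1" "i \<le> a" "i + 1 \<le> a" using 1 by (simp_all add: t_def)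
    then have "(\<lambda>x. P x (i + 1)) = (\<lambda>(v, j). h (v, min t j))"
      "(\<lambda>x. P x i) = (\<lambda>(v, j). h (v, min (t + 1) j))"
      by (simp_all add: P_def extended_path_def fun_eq_iff t_def)
    then show ?thesis
      using truncated_homotopy_simplex[OF K L h \<sigma>, of t] by (simp only: Un_commute)
  next
    case 2
    have p: "fst ` \<sigma> \<in> L" and sub: "\<sigma> \<subseteq> vertex_set L \<times> vertex_set (interval_complex m)"
      using \<sigma> by (simp_all add: product_complex_def)
    have P: "P x i = \<phi> (fst x, 0) i" "P x (i + 1) = \<phi> (fst x, 0) (i + 1)" if "x \<in> \<sigma>" for x
      using 2 that sub ends unfolding P_def
      by (cases x; auto intro!: extended_path_middle)+
    \<comment> \<open>In the middle region the level is forgotten, so \<open>\<sigma>\<close>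
      matters only through its projection to \<open>L\<close>, placed at level 0.\<close>
    have "fst ` \<sigma> \<times> {0} \<in> product_complex L {{0 :: nat}}"
      by (rule times_in_product_complex[OF L _ p])
        (auto simp: abstract_simplicial_complex_def subset_singleton_iff)
    then have "\<phi> ` (fst ` \<sigma> \<times> {0}) \<in> moore_path_complex K" by (rule simplicial_map_image[OF \<phi>])
    moreover have "fst ` \<sigma> \<times> {0} = (\<lambda>x. (fst x, 0 :: nat)) ` \<sigma>" by auto
    ultimately show ?thesis
      by (simp add: moore_path_complex_def image_image P cong: image_cong)
  next
    case 3
    define t where "t = nat (i - b)"
    have "nat (i + 1 - b) = t + 1" using 3 by (simp add: t_def)
    then have "(\<lambda>x. P x i) = (\<lambda>(v, j). k (v, min t j))"
      "(\<lambda>x. P x (i + 1)) = (\<lambda>(v, j). k (v, min (t + 1) j))"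
      using 3 ab by (simp_all add: P_def extended_path_def fun_eq_iff t_def)
    then show ?thesis using truncated_homotopy_simplex[OF K L k \<sigma>, of t] by (simp only:)
  qed
qed

lemma simplicial_map_extended_path:
  assumes K: "abstract_simplicial_complex K" and L: "abstract_simplicial_complex L"
    and h: "simplicial_map (product_complex L (interval_complex m)) K h"
    and k: "simplicial_map (product_complex L (interval_complex m)) K k"
    and \<phi>: "simplicial_map (product_complex L {{0}}) (moore_path_complex K) \<phi>"
    and ends: "\<And>v. v \<in> vertex_set L \<Longrightarrow> \<phi> (v, 0) a = h (v, 0)"
      "\<And>v. v \<in> vertex_set L \<Longrightarrow> \<phi> (v, 0) b = k (v, 0)"
    and ab: "a < b"
  shows "simplicial_map (product_complex L (interval_complex m)) (moore_path_complex K)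
    (extended_path a b h k \<phi>)"
proof (rule simplicial_mapI)
  let ?M = "product_complex L (interval_complex m)" and ?P = "extended_path a b h k \<phi>"
  have M: "abstract_simplicial_complex ?M"
    by (intro abstract_simplicial_complex_product L abstract_simplicial_complex_interval)
  have simplex: "(\<lambda>x. ?P x i) ` \<tau> \<union> (\<lambda>x. ?P x (i + 1)) ` \<tau> \<in> K" if "\<tau> \<in> ?M" for \<tau> i
    by (rule extended_path_simplex[OF K L h k \<phi> _ _ that ab]) (simp_all add: ends)
  fix \<sigma> assume \<sigma>: "\<sigma> \<in> ?M"
  then have fin: "finite \<sigma>" "\<sigma> \<noteq> {}"
    using M unfolding abstract_simplicial_complex_def by blast+
  have "moore_path K (?P (v, j))" if "(v, j) \<in> \<sigma>" for v j
    unfolding moore_path_def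
  \<comment> \<open>The bounds of the path are left open here and become \<open>a - int j\<close>
    and \<open>b + int j\<close> below, where the outer pieces have reached time
    \<open>j\<close>.\<close>
  proof (intro conjI exI allI impI simplicial_mapI)
    \<comment> \<open>Applied to a singleton, the joint edge condition says that the single path is
      simplicial on the line.\<close>
    have "{(v, j)} \<in> ?M" by (rule abstract_simplicial_complex_subset[OF M \<sigma>]) (use that in auto)
    then have edge: "{?P (v, j) i, ?P (v, j) (i + 1)} \<in> K" for i
      using simplex[of "{(v, j)}" i] by (simp add: insert_commute)
    then have "{?P (v, j) i} \<in> K" for i
      using abstract_simplicial_complex_subset[OF K edge[of i], of "{?P (v, j) i}"] by simp
    then show "?P (v, j) ` \<tau> \<in> K" if "\<tau> \<in> line_complex" for \<tau>
      using that edge by (auto simp: line_complex_def)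
    show "?P (v, j) i = ?P (v, j) (a - int j)" if "i \<le> a - int j" for i
      using that by (simp add: extended_path_left)
    show "?P (v, j) i = ?P (v, j) (b + int j)" if "b + int j \<le> i" for i
      using that ab by (simp add: extended_path_right)
  qed
  then show "?P ` \<sigma> \<in> moore_path_complex K"
    using fin simplex[OF \<sigma>] by (auto simp: moore_path_complex_def image_image)
qed

theorem theorem5p6:
  fixes K :: "'a set set"
  assumes "abstract_simplicial_complex K"
  shows "simplicial_finite_fibration TYPE('l)
           (moore_path_complex K) (product_complex K K) endpoint_map"
  unfolding simplicial_finite_fibration_def
proof (intro conjI allI impI simplicial_map_endpoint_map assms)
  fix L :: "'l set set" and m :: nat and H \<phi>
  let ?M = "product_complex L (interval_complex m)"
  assume L: "abstract_simplicial_complex L" and fin: "finite (vertex_set L)"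
    and H: "simplicial_map ?M (product_complex K K) H"
    and \<phi>: "simplicial_map (product_complex L {{0 :: nat}}) (moore_path_complex K) \<phi>"
    and start: "\<forall>v\<in>vertex_set L. endpoint_map (\<phi> (v, 0)) = H (v, 0)"
  have "moore_path K (\<phi> (v, 0))" if "v \<in> vertex_set L" for v
  proof -
    have "{v} \<times> {0} \<in> product_complex L {{0 :: nat}}"
      using that
      by (intro times_in_product_complex L)
        (auto simp: vertex_set_iff[OF L] abstract_simplicial_complex_def[of "{{0}}"]
          subset_singleton_iff)
    from simplicial_map_image[OF \<phi> this] show ?thesis by (simp add: moore_path_complex_def)
  qed
  then have moore: "\<gamma> \<in> (\<lambda>v. \<phi> (v, 0)) ` vertex_set L \<Longrightarrow> moore_path K \<gamma>" for \<gamma> by blast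
  obtain a b where ab: "a < b"
    and left: "\<And>\<gamma> i. \<gamma> \<in> (\<lambda>v. \<phi> (v, 0)) ` vertex_set L \<Longrightarrow> i \<le> a \<Longrightarrow> \<gamma> i = initial_vertex \<gamma>"
    and right: "\<And>\<gamma> i. \<gamma> \<in> (\<lambda>v. \<phi> (v, 0)) ` vertex_set L \<Longrightarrow> b \<le> i \<Longrightarrow> \<gamma> i = final_vertex \<gamma>"
    by (rule moore_path_bounds[OF finite_imageI[OF fin, of "\<lambda>v. \<phi> (v, 0)"] moore]) (assumption, rule that)
  define h k where "h = (\<lambda>x. fst (H x))" and "k = (\<lambda>x. snd (H x))"
  have hk: "simplicial_map ?M K h" "simplicial_map ?M K k"
    unfolding h_def k_def by (rule simplicial_map_product_components[OF H])+
  \<comment> \<open>The lifting hypothesis at level 0, read componentwise, is exactly the matching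
    needed at the two junctions.\<close>
  have ends: "initial_vertex (\<phi> (v, 0)) = h (v, 0)" "final_vertex (\<phi> (v, 0)) = k (v, 0)"
    if "v \<in> vertex_set L" for v
    unfolding h_def k_def bspec[OF start that, symmetric] by (simp_all add: endpoint_map_def)
  have left': "\<phi> (v, 0) i = h (v, 0)" if "v \<in> vertex_set L" "i \<le> a" for v i
    using left[OF imageI[OF that(1)] that(2)] ends(1)[OF that(1)] by (rule trans)
  have right': "\<phi> (v, 0) i = k (v, 0)" if "v \<in> vertex_set L" "b \<le> i" for v i
    using right[OF imageI[OF that(1)] that(2)] ends(2)[OF that(1)] by (rule trans)
  show "\<exists>H'. simplicial_map ?M (moore_path_complex K) H' \<and>
      (\<forall>v\<in>vertex_set L. H' (v, 0) = \<phi> (v, 0)) \<and>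
      (\<forall>x\<in>vertex_set ?M. endpoint_map (H' x) = H x)"
  proof (intro exI conjI ballI)
    show "simplicial_map ?M (moore_path_complex K) (extended_path a b h k \<phi>)"
      by (rule simplicial_map_extended_path[OF assms L hk \<phi> _ _ ab]) (simp_all add: left' right')
    show "extended_path a b h k \<phi> (v, 0) = \<phi> (v, 0)" if "v \<in> vertex_set L" for v
      using that by (intro extended_path_0) (simp_all add: left' right')
    show "endpoint_map (extended_path a b h k \<phi> x) = H x" for x
      using endpoint_map_extended_path[OF ab, of h k \<phi> "fst x" "snd x"]
      by (simp add: h_def k_def)
  qed
qed

end
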